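(* Let $n\ge1$ and let $p\in\operatorname{Trop}[x_1,\ldots,x_n]$ be a symmetric tropical polynomial. Apply to the minimal representation of $p$ the algorithm described in the context, obtaining an expression $\bigoplus_{j=1}^{N} a_j\odot e_1^{m_1^j}\odot\cdots\odot e_n^{m_n^j}$ in the elementary symmetric tropical polynomials $e_1,\ldots,e_n$ and $e_n^{-1}$. Then this expression in $e_1,\ldots,e_n$ and $e_n^{-1}$ is also minimal; that is, for each $1\le j\le N$ there is a point $x=(x_1,\ldots,x_n)\in\mathbb{R}^n$ such that $$a_j+m_1^je_1(x)+\cdots+m_n^je_n(x)<a_s+m_1^se_1(x)+\cdots+m_n^se_n(x)\quad\text{for all } 1\le s\le N,\ s\ne j.$$
   Context: Tropical arithmetic: $a\oplus b=\min(a,b)$, $a\odot b=a+b$; $b^{-1}$ denotes $-b$, and $x^i$ is the tropical power (ordinary $i\cdot x$). A tropical polynomial expression in $x_1,\ldots,x_n$ is a finite (nonempty) tropical sum $\bigoplus_{j=1}^m a_j\odot x_1^{i_1^j}\odot\cdots\odot x_n^{i_n^j}$ with $a_j\in\mathbb{R}$, $i_k^j\in\mathbb{Z}$; it defines the function $x\mapsto\min_j(a_j+i_1^jx_1+\cdots+i_n^jx_n)$ on $\mathbb{R}^n$. $\operatorname{Trop}[x_1,\ldots,x_n]$ is the semiring of tropical polynomial expressions modulo defining the same function; its elements are tropical polynomials. $p$ is symmetric if $p(x_1,\ldots,x_n)=p(x_{\pi(1)},\ldots,x_{\pi(n)})$ for every $\pi\in S_n$. For a tropical polynomial $p$, $\operatorname{Sym}(p)=\bigoplus_{\pi\in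 S_n}p(x_{\pi(1)},\ldots,x_{\pi(n)})$, and $e_k=\operatorname{Sym}(x_1\odot\cdots\odot x_k)$ for $1\le k\le n$. Minimal representation: the minimal representation of a tropical polynomial $p$ is a tropical polynomial expression $\bigoplus_{j=1}^m a_j\odot x_1^{i_1^j}\cdots x_n^{i_n^j}$ defining $p$ such that for each $j$ there is a point $(x_1,\ldots,x_n)\in\mathbb{R}^n$ with $a_j+i_1^jx_1+\cdots+i_n^jx_n<\min_{s\ne j}(a_s+i_1^sx_1+\cdots+i_n^sx_n)$. Minimal symmetrization: if $p$ is symmetric, then the set of terms of its minimal representation is closed under permuting variables. It is a disjoint union of $S_n$-orbits of terms $a\odot x_1^{i_1}\cdots x_n^{i_n}$; the tropical sum of the distinct terms of such an orbit is denoted $\operatorname{MinSym}(a\odot x_1^{i_1}\cdots x_n^{i_n})$ and equals $\operatorname{Sym}(a\odot x_1^{i_1}\cdots x_n^{i_n})$ as a function. Algorithm: given the minimal representation of a symmetric $p$, multiply by $e_n^k$ for an integer $k$ such that all exponents of $p\odot e_n^k$ become nonnegative, and write the result as the tropical sum of minimal symmetrizations, one for each orbit of terms. For each orbit, rewrite $a\odot\operatorname{Sym}(x_1^{i_1}\odot\cdots\odot x_m^{i_m})$ (where $i_1,\ldots,i_m$ are the nonzero, hence positive, exponents) as $a\odot e_m^{b}\odot\operatorname{Sym}(x_1^{i_1-b}\odot\cdots\odot x_m^{i_m-b})$ with $b=\min(i_1,\ldots,i_m)$, and repeat on the remaining symmetrization until all exponents are $0$. Finally multiply everything by $e_n^{-k}$.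 Thus the output has exactly one term for each $S_n$-orbit of terms of the minimal representation of $p$: the orbit of $a\odot x_1^{\lambda_1}\cdots x_n^{\lambda_n}$ with $\lambda_1\ge\lambda_2\ge\cdots\ge\lambda_n$ (original exponents, possibly negative) yields the term $a\odot e_1^{\lambda_1-\lambda_2}\odot\cdots\odot e_{n-1}^{\lambda_{n-1}-\lambda_n}\odot e_n^{\lambda_n}$. *)

theory Defs
  imports "HOL-Analysis.Analysis"
begin

text \<open>
  The variables \<open>x\<^sub>1, \<dots>, x\<^sub>n\<close> are indexed by a finite linearly ordered type \<open>'n\<close> with
  \<open>n = CARD('n)\<close>; the order is only used to speak of the first \<open>k\<close> variables.
  A tropical term \<open>(a, i)\<close> in variables indexed by \<open>I\<close> stands for the tropical product of \<open>a\<close>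
  and the powers \<open>y\<^sub>v\<close> to the \<open>i\<^sub>v\<close>.  A tropical expression is a nonempty list of terms, so that
  repeated terms are allowed and terms are distinguished by their position.
\<close>

type_synonym 'v trop_term = "real \<times> ('v \<Rightarrow> int)"

definition term_val :: "'v set \<Rightarrow> ('v \<Rightarrow> real) \<Rightarrow> 'v trop_term \<Rightarrow> real" where
  "term_val I y t = fst t + (\<Sum>v\<in>I. of_int (snd t v) * y v)"

definition trop_fun :: "'n::finite trop_term list \<Rightarrow> real ^ 'n \<Rightarrow> real" where
  "trop_fun P x = Min (term_val UNIV (\<lambda>v. x $ v) ` set P)"

text \<open>
  Tropical polynomials are expressions modulo defining the same function; a class is identified
  with the function it defines.
\<close>

definition trop_polys :: "(real ^ 'n::finite \<Rightarrow> real) set" where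
  "trop_polys = {trop_fun P | P. P \<noteq> []}"

definition permute_vars :: "('n \<Rightarrow> 'n) \<Rightarrow> real ^ 'n \<Rightarrow> real ^ 'n::finite" where
  "permute_vars \<pi> x = (\<chi> v. x $ \<pi> v)"

definition trop_symmetric :: "(real ^ 'n::finite \<Rightarrow> real) \<Rightarrow> bool" where
  "trop_symmetric p \<longleftrightarrow> (\<forall>\<pi>. \<pi> permutes UNIV \<longrightarrow> (\<forall>x. p (permute_vars \<pi> x) = p x))"

definition trop_Sym :: "(real ^ 'n::finite \<Rightarrow> real) \<Rightarrow> real ^ 'n \<Rightarrow> real" where
  "trop_Sym p x = Min ((\<lambda>\<pi>. p (permute_vars \<pi> x)) ` {\<pi>. \<pi> permutes UNIV})"

text \<open>\<open>{v. card {..v} \<le> k}\<close> consists of the first \<open>k\<close> indices.\<close>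

definition trop_esym :: "nat \<Rightarrow> real ^ 'n::{finite,linorder} \<Rightarrow> real" where
  "trop_esym k = trop_Sym (\<lambda>x. \<Sum>v | card {..v} \<le> k. x $ v)"

definition minimal_rep :: "'n::finite trop_term list \<Rightarrow> (real ^ 'n \<Rightarrow> real) \<Rightarrow> bool" where
  "minimal_rep P p \<longleftrightarrow> P \<noteq> [] \<and> trop_fun P = p \<and>
     (\<forall>j<length P. \<exists>x :: real ^ 'n. \<forall>s<length P. s \<noteq> j \<longrightarrow>
        term_val UNIV (\<lambda>v. x $ v) (P ! j) < term_val UNIV (\<lambda>v. x $ v) (P ! s))"

definition term_orbit :: "'n trop_term \<Rightarrow> 'n trop_term set" where
  "term_orbit t = {(fst t, snd t \<circ> \<pi>) | \<pi>. \<pi> permutes UNIV}"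

text \<open>Since \<open>e\<^sub>n\<close> is the product of all variables, \<open>e\<^sub>n\<close> to the \<open>k\<close> adds \<open>k\<close> to every exponent.\<close>

definition shift_term :: "int \<Rightarrow> 'n trop_term \<Rightarrow> 'n trop_term" where
  "shift_term k t = (fst t, \<lambda>v. snd t v + k)"

text \<open>
  Rewriting of the symmetrization of the monomial with exponents \<open>i\<close>: with \<open>m\<close> nonzero exponents
  of minimum \<open>b\<close>, split off \<open>e\<^sub>m\<close> to the \<open>b\<close> and continue with \<open>b\<close> subtracted from the nonzero
  exponents.  The result maps \<open>m\<close> to the exponent accumulated at \<open>e\<^sub>m\<close>.
\<close>

function elem_exps :: "('n::finite \<Rightarrow> nat) \<Rightarrow> nat \<Rightarrow> nat" where
  "elem_exps i =
     (if \<forall>v. i v = 0 then (\<lambda>_. 0)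
      else let S = {v. i v \<noteq> 0}; b = Min (i ` S);
               r = elem_exps (\<lambda>v. if v \<in> S then i v - b else 0)
           in r(card S := r (card S) + b))"
  by pat_completeness auto
termination
proof (relation "Wellfounded.measure (\<lambda>i. \<Sum>v\<in>UNIV. i v)", simp)
  fix i :: "'n::finite \<Rightarrow> nat" and S b
  assume nz: "\<not> (\<forall>v. i v = 0)" and S: "S = {v. i v \<noteq> 0}" and b: "b = Min (i ` S)"
  from nz obtain w where w: "w \<in> S" using S by auto
  have "b \<in> i ` S" unfolding b using w by (intro Min_in finite_imageI finite) auto
  then have "b > 0" using S by auto
  then have "(if w \<in> S then i w - b else 0) < i w" using w S by auto
  then have "(\<Sum>v\<in>UNIV. if v \<in> S then i v - b else 0) < (\<Sum>v\<in>UNIV. i v)"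
    by (intro sum_strict_mono_ex1 bexI[of _ w]) simp_all
  then show "((\<lambda>v. if v \<in> S then i v - b else 0), i) \<in> Wellfounded.measure (\<lambda>i. \<Sum>v\<in>UNIV. i v)"
    by simp
qed

declare elem_exps.simps [simp del]

text \<open>
  \<open>Q\<close> is an output of the algorithm on the expression \<open>P\<close>.  The choices left open by the algorithm
  are existentially quantified: the exponent \<open>k\<close>, the order \<open>Os\<close> in which the orbits are listed,
  and the term \<open>t\<close> representing its orbit.  The terms of \<open>Q\<close> are in the variables
  \<open>e\<^sub>1, \<dots>, e\<^sub>n\<close>, with exponents indexed by \<open>{1..CARD('n)}\<close>; there is one for each orbit, even if
  the same term were to arise from two orbits.
\<close>

definition elem_algorithm :: "'n::finite trop_term list \<Rightarrow> nat trop_term list \<Rightarrow> bool" where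
  "elem_algorithm P Q \<longleftrightarrow>
     (\<exists>k Os. (\<forall>t\<in>set P. \<forall>v. 0 \<le> snd (shift_term k t) v) \<and>
        distinct Os \<and> set Os = term_orbit ` shift_term k ` set P \<and>
        list_all2 (\<lambda>T q. \<exists>t\<in>T. q = (fst t,
            \<lambda>m. int (elem_exps (\<lambda>v. nat (snd t v)) m) - (if m = CARD('n) then k else 0))) Os Q)"

end

theory Submission
  imports Defs
begin

text \<open>
  By the rearrangement inequality, the term produced from the orbit of a term \<open>t\<close> takes at \<open>x\<close> the
  value \<open>min t(x \<circ> \<pi>)\<close> over all permutations \<open>\<pi>\<close>.  Let \<open>x\<close> be a point where the term \<open>t\<close> of the
  minimal representation is strictly minimal, so that \<open>p = t\<close> near \<open>x\<close>.  If \<open>u\<close> is another term, then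
  by symmetry \<open>u(y \<circ> \<pi>) \<ge> p(y \<circ> \<pi>) = p(y) = t(y)\<close> for \<open>y\<close> near \<open>x\<close>; equality at \<open>y = x\<close> forces the two
  affine functions to coincide, i.e. \<open>u\<close> to lie in the orbit of \<open>t\<close>.  Hence \<open>x\<close> also witnesses
  minimality of the term produced from the orbit of \<open>t\<close>.
\<close>

lemma ex_permutes_image_eq:
  fixes A B :: "'a::finite set"
  assumes "card A = card B"
  shows "\<exists>\<sigma>. \<sigma> permutes UNIV \<and> \<sigma> ` A = B"
proof -
  obtain f where f: "bij_betw f A B"
    using assms finite_same_card_bij[of A B] by auto
  have "card (- A) = card (- B)"
    using assms by (simp add: Compl_eq_Diff_UNIV card_Diff_subset)
  then obtain g where g: "bij_betw g (- A) (- B)"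
    using finite_same_card_bij[of "- A" "- B"] by auto
  let ?h = "\<lambda>v. if v \<in> A then f v else g v"
  have hA: "bij_betw ?h A B"
    using f by (simp cong: bij_betw_cong)
  have "bij_betw ?h (- A) (- B)"
    using g by (subst bij_betw_cong[of "- A" ?h g]) auto
  then have "bij_betw ?h (A \<union> - A) (B \<union> - B)"
    by (intro bij_betw_combine[OF hA]) auto
  then have "?h permutes UNIV"
    by (intro bij_imp_permutes) auto
  moreover have "?h ` A = B"
    using hA by (rule bij_betw_imp_surj_on)
  ultimately show ?thesis by blast
qed

lemma card_initial_segment:
  assumes "k \<le> CARD('n::{finite,linorder})"
  shows "card {v::'n. card {..v} \<le> k} = k"
proof -
  let ?r = "\<lambda>v::'n. card {..v}"
  have "strict_mono ?r"
    by (intro strict_monoI psubset_card_mono) auto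
  then have inj: "inj ?r" by (rule strict_mono_imp_inj_on)
  have "?r v \<in> {1..CARD('n)}" for v
    using card_mono[of UNIV "{..v}"] by (auto simp: Suc_le_eq card_gt_0_iff)
  then have "range ?r = {1..CARD('n)}"
    by (intro card_subset_eq) (auto simp: card_image[OF inj])
  then have "?r ` {v. ?r v \<le> k} = {1..k}"
    using assms by (auto simp: set_eq_iff image_iff) (metis le_trans)
  then show ?thesis
    using card_image[OF inj_on_subset[OF inj subset_UNIV], of "{v. ?r v \<le> k}"] by simp
qed

lemma trop_esym_eq_Min:
  "trop_esym k x = Min ((\<lambda>\<pi>. \<Sum>v | card {..v} \<le> k. x $ \<pi> v) ` {\<pi>. \<pi> permutes UNIV})"
  by (simp add: trop_esym_def trop_Sym_def permute_vars_def)

lemma trop_esym_le_sum: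
  fixes S :: "'n::{finite,linorder} set"
  assumes "\<pi> permutes UNIV"
  shows "trop_esym (card S) x \<le> (\<Sum>v\<in>S. x $ \<pi> v)"
proof -
  let ?F = "{v::'n. card {..v} \<le> card S}"
  have "card ?F = card S"
    by (intro card_initial_segment card_mono) auto
  then obtain \<sigma> where \<sigma>: "\<sigma> permutes UNIV" "\<sigma> ` ?F = S"
    using ex_permutes_image_eq by blast
  have "(\<Sum>v\<in>S. x $ \<pi> v) = (\<Sum>v\<in>?F. x $ (\<pi> \<circ> \<sigma>) v)"
    using \<sigma> by (subst \<sigma>(2)[symmetric], subst sum.reindex) (auto intro: inj_on_subset permutes_inj)
  then show ?thesis
    unfolding trop_esym_eq_Min
    by (intro Min_le) (auto intro!: image_eqI[of _ _ "\<pi> \<circ> \<sigma>"] permutes_compose \<sigma>(1) assms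
        simp: finite_permutations)
qed

lemma sum_le_sum_of_bottom_set:
  fixes y :: "'a::finite \<Rightarrow> real"
  assumes card: "card S = card U" and bottom: "\<And>v w. v \<in> S \<Longrightarrow> w \<notin> S \<Longrightarrow> y v \<le> y w"
  shows "sum y S \<le> sum y U"
proof -
  have "card (S - U) = card (U - S)"
    using card by (simp add: card_Diff_subset_Int Int_commute)
  then obtain f where f: "bij_betw f (S - U) (U - S)"
    using finite_same_card_bij[of "S - U" "U - S"] by auto
  have "sum y (S - U) \<le> (\<Sum>v\<in>S - U. y (f v))"
    using f by (intro sum_mono bottom) (auto simp: bij_betw_def)
  also have "\<dots> = sum y (U - S)"
    using f by (rule sum.reindex_bij_betw)
  finally show ?thesis
    using sum.Int_Diff[of S y U] sum.Int_Diff[of U y S] by (simp add: Int_commute)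
qed

lemma trop_esym_eq_sum:
  fixes S :: "'n::{finite,linorder} set"
  assumes \<pi>: "\<pi> permutes UNIV" and bottom: "\<And>v w. v \<in> S \<Longrightarrow> w \<notin> S \<Longrightarrow> x $ \<pi> v \<le> x $ \<pi> w"
  shows "trop_esym (card S) x = (\<Sum>v\<in>S. x $ \<pi> v)"
proof (rule antisym[OF trop_esym_le_sum[OF \<pi>]])
  let ?F = "{v::'n. card {..v} \<le> card S}"
  have "trop_esym (card S) x \<in> (\<lambda>\<pi>. \<Sum>v\<in>?F. x $ \<pi> v) ` {\<pi>. \<pi> permutes UNIV}"
    unfolding trop_esym_eq_Min
    by (intro Min_in) (auto simp: finite_permutations intro: permutes_id)
  then obtain \<tau> where \<tau>: "\<tau> permutes UNIV" "trop_esym (card S) x = (\<Sum>v\<in>?F. x $ \<tau> v)"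
    by auto
  let ?\<rho> = "inv \<pi> \<circ> \<tau>"
  have \<rho>: "inj_on ?\<rho> ?F"
    by (rule inj_on_subset[OF permutes_inj[OF permutes_compose[OF \<tau>(1) permutes_inv[OF \<pi>]]]]) simp
  have "card S = card (?\<rho> ` ?F)"
    using card_image[OF \<rho>] card_initial_segment[of "card S", where 'n = 'n]
    by (simp add: card_mono)
  then have "(\<Sum>v\<in>S. x $ \<pi> v) \<le> (\<Sum>v\<in>?\<rho> ` ?F. x $ \<pi> v)"
    by (rule sum_le_sum_of_bottom_set) (rule bottom)
  also have "\<dots> = trop_esym (card S) x"
    using sum.reindex[OF \<rho>, of "\<lambda>v. x $ \<pi> v"] \<tau>(2) by (simp add: permutes_inverses[OF \<pi>])
  finally show "(\<Sum>v\<in>S. x $ \<pi> v) \<le> trop_esym (card S) x" .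
qed

lemma trop_esym_CARD:
  fixes x :: "real ^ 'n::{finite,linorder}"
  shows "trop_esym CARD('n) x = (\<Sum>v\<in>UNIV. x $ v)"
  using trop_esym_eq_sum[OF permutes_id, of UNIV x] by simp

lemma ex_antimono_permutation:
  fixes i :: "'n::finite \<Rightarrow> nat" and x :: "'n \<Rightarrow> real"
  shows "\<exists>\<pi>. \<pi> permutes UNIV \<and> (\<forall>v w. i w < i v \<longrightarrow> x (\<pi> v) \<le> x (\<pi> w))"
proof -
  let ?f = "\<lambda>\<pi>. \<Sum>v\<in>UNIV. real (i v) * x (\<pi> v)"
  let ?S = "{\<pi> :: 'n \<Rightarrow> 'n. \<pi> permutes UNIV}"
  have "finite ?S" "?S \<noteq> {}"
    by (auto simp: finite_permutations intro: permutes_id)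
  from ex_is_arg_min_if_finite[OF this, of ?f] obtain \<pi> :: "'n \<Rightarrow> 'n"
    where \<pi>: "\<pi> permutes UNIV" and min: "\<And>\<sigma>. \<sigma> permutes UNIV \<Longrightarrow> ?f \<pi> \<le> ?f \<sigma>"
    by (auto simp: is_arg_min_linorder)
  have "x (\<pi> v) \<le> x (\<pi> w)" if less: "i w < i v" for v w
  proof -
    let ?\<sigma> = "\<pi> \<circ> Transposition.transpose v w"
    have ne: "v \<noteq> w" using less by auto
    have \<sigma>: "?\<sigma> permutes UNIV"
      by (intro permutes_compose permutes_swap_id \<pi>) auto
    have split: "sum g UNIV = g v + g w + sum g (UNIV - {v, w})" for g :: "'n \<Rightarrow> real"
      using ne sum.subset_diff[of "{v, w}" UNIV g] by simp
    have rest: "(\<Sum>u\<in>UNIV - {v, w}. real (i u) * x (?\<sigma> u))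
        = (\<Sum>u\<in>UNIV - {v, w}. real (i u) * x (\<pi> u))"
      by (intro sum.cong) (auto simp: Transposition.transpose_def)
    have "real (i v) * x (\<pi> v) + real (i w) * x (\<pi> w)
        \<le> real (i v) * x (\<pi> w) + real (i w) * x (\<pi> v)"
      using min[OF \<sigma>] rest split[of "\<lambda>u. real (i u) * x (\<pi> u)"]
        split[of "\<lambda>u. real (i u) * x (?\<sigma> u)"] by simp
    then have "(real (i v) - real (i w)) * (x (\<pi> v) - x (\<pi> w)) \<le> 0"
      by (simp add: algebra_simps)
    then show ?thesis
      using less by (simp add: mult_le_0_iff)
  qed
  with \<pi> show ?thesis by blast
qed

definition elem_val :: "('n::{finite,linorder} \<Rightarrow> nat) \<Rightarrow> real ^ 'n::{finite,linorder} \<Rightarrow> real" where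
  "elem_val i x = (\<Sum>m\<in>{1..CARD('n)}. real (elem_exps i m) * trop_esym m x)"

lemma elem_val_zero: "\<forall>v. i v = 0 \<Longrightarrow> elem_val i x = 0"
  by (simp add: elem_val_def elem_exps.simps)

lemma elem_val_step:
  fixes i :: "'n::{finite,linorder} \<Rightarrow> nat"
  assumes "\<not> (\<forall>v. i v = 0)" and S: "S = {v. i v \<noteq> 0}" and b: "b = Min (i ` S)"
  shows "elem_val i x
    = elem_val (\<lambda>v. if v \<in> S then i v - b else 0) x + real b * trop_esym (card S) x"
proof -
  let ?i' = "\<lambda>v. if v \<in> S then i v - b else 0"
  have mem: "card S \<in> {1..CARD('n)}"
    using assms card_mono[of UNIV S] by (auto simp: Suc_le_eq card_gt_0_iff)
  have "elem_exps i = (elem_exps ?i')(card S := elem_exps ?i' (card S) + b)"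
    using elem_exps.simps[of i]
    unfolding if_not_P[OF assms(1)] Let_def S[symmetric] b[symmetric] .
  then have "elem_val i x = (\<Sum>m\<in>{1..CARD('n)}. real (elem_exps ?i' m) * trop_esym m x
      + (if m = card S then real b * trop_esym (card S) x else 0))"
    unfolding elem_val_def by (intro sum.cong) (auto simp: algebra_simps)
  also have "\<dots> = elem_val ?i' x + real b * trop_esym (card S) x"
    using mem unfolding elem_val_def sum.distrib by simp
  finally show ?thesis .
qed

lemma sum_split_min:
  fixes i :: "'n::finite \<Rightarrow> nat" and y :: "'n \<Rightarrow> real"
  assumes S: "S = {v. i v \<noteq> 0}" and b: "b = Min (i ` S)"
  shows "(\<Sum>v\<in>UNIV. real (i v) * y v)
    = (\<Sum>v\<in>UNIV. real (if v \<in> S then i v - b else 0) * y v) + real b * (\<Sum>v\<in>S. y v)"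
proof -
  have "b \<le> i v" if "v \<in> S" for v
    using that b by simp
  then have "(\<Sum>v\<in>UNIV. real (i v) * y v)
      = (\<Sum>v\<in>UNIV. real (if v \<in> S then i v - b else 0) * y v + (if v \<in> S then real b * y v else 0))"
    using S by (intro sum.cong) (auto simp: of_nat_diff algebra_simps)
  then show ?thesis
    by (simp add: sum.distrib sum_distrib_left flip: sum.inter_restrict)
qed

lemma elem_val_le:
  assumes "\<pi> permutes UNIV"
  shows "elem_val i x \<le> (\<Sum>v\<in>UNIV. real (i v) * x $ \<pi> v)"
proof (induction i rule: elem_exps.induct)
  case (1 i)
  show ?case
  proof (cases "\<forall>v. i v = 0")
    case True
    then show ?thesis by (simp add: elem_val_zero)
  next
    case False
    define S where "S = {v. i v \<noteq> 0}"
    define b where "b = Min (i ` S)"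
    have "real b * trop_esym (card S) x \<le> real b * (\<Sum>v\<in>S. x $ \<pi> v)"
      by (intro mult_left_mono trop_esym_le_sum[OF assms]) simp
    then show ?thesis
      using "1.IH"[OF False S_def b_def]
      unfolding elem_val_step[OF False S_def b_def] sum_split_min[OF S_def b_def] by linarith
  qed
qed

lemma elem_val_antimono:
  assumes "\<pi> permutes UNIV" and "\<And>v w. i w < i v \<Longrightarrow> x $ \<pi> v \<le> x $ \<pi> w"
  shows "elem_val i x = (\<Sum>v\<in>UNIV. real (i v) * x $ \<pi> v)"
  using assms(2)
proof (induction i rule: elem_exps.induct)
  case (1 i)
  show ?case
  proof (cases "\<forall>v. i v = 0")
    case True
    then show ?thesis by (simp add: elem_val_zero)
  next
    case False
    define S where "S = {v. i v \<noteq> 0}"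
    define b where "b = Min (i ` S)"
    have "trop_esym (card S) x = (\<Sum>v\<in>S. x $ \<pi> v)"
      by (rule trop_esym_eq_sum[OF assms(1)]) (auto simp: S_def intro: "1.prems")
    moreover have "i w < i v"
      if "(if w \<in> S then i w - b else 0) < (if v \<in> S then i v - b else 0)" for v w
      using that by (auto simp: S_def split: if_splits)
    then have "elem_val (\<lambda>v. if v \<in> S then i v - b else 0) x
        = (\<Sum>v\<in>UNIV. real (if v \<in> S then i v - b else 0) * x $ \<pi> v)"
      by (intro "1.IH"[OF False S_def b_def] "1.prems") blast
    ultimately show ?thesis
      unfolding elem_val_step[OF False S_def b_def] sum_split_min[OF S_def b_def] by (simp only:)
  qed
qed

definition output_term :: "int \<Rightarrow> 'n::finite trop_term \<Rightarrow> nat trop_term" where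
  "output_term k t = (fst t,
     \<lambda>m. int (elem_exps (\<lambda>v. nat (snd t v)) m) - (if m = CARD('n) then k else 0))"

lemma term_val_output_term:
  fixes x :: "real ^ 'n::{finite,linorder}"
  shows "term_val {1..CARD('n)} (\<lambda>m. trop_esym m x) (output_term k t)
    = fst t + elem_val (\<lambda>v. nat (snd t v)) x - of_int k * (\<Sum>v\<in>UNIV. x $ v)"
proof -
  have "term_val {1..CARD('n)} (\<lambda>m. trop_esym m x) (output_term k t)
      = fst t + (\<Sum>m\<in>{1..CARD('n)}. real (elem_exps (\<lambda>v. nat (snd t v)) m) * trop_esym m x
          - (if m = CARD('n) then of_int k * trop_esym CARD('n) x else 0))"
    unfolding term_val_def output_term_def by (auto simp: algebra_simps intro!: sum.cong)
  then show ?thesis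
    by (simp add: sum_subtractf elem_val_def trop_esym_CARD Suc_le_eq)
qed

lemma sum_shifted_exps:
  fixes x :: "real ^ 'n::finite" and c :: "'n \<Rightarrow> int"
  assumes \<pi>: "\<pi> permutes UNIV" and \<rho>: "\<rho> permutes UNIV" and nonneg: "\<And>v. 0 \<le> c v + k"
  shows "(\<Sum>v\<in>UNIV. real (nat (c (\<rho> v) + k)) * x $ \<pi> v)
    = (\<Sum>v\<in>UNIV. of_int (c v) * x $ \<pi> (inv \<rho> v)) + of_int k * (\<Sum>v\<in>UNIV. x $ v)"
proof -
  have "(\<Sum>v\<in>UNIV. real (nat (c (\<rho> v) + k)) * x $ \<pi> v)
      = (\<Sum>v\<in>UNIV. of_int (c (\<rho> v)) * x $ \<pi> v) + of_int k * (\<Sum>v\<in>UNIV. x $ \<pi> v)"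
    using nonneg by (simp add: sum_distrib_left distrib_right flip: sum.distrib)
  also have "(\<Sum>v\<in>UNIV. of_int (c (\<rho> v)) * x $ \<pi> v)
      = (\<Sum>v\<in>UNIV. of_int (c v) * x $ \<pi> (inv \<rho> v))"
    using sum.permute[OF \<rho>, of "\<lambda>v. of_int (c v) * x $ \<pi> (inv \<rho> v)"]
    by (simp add: permutes_inverses[OF \<rho>])
  also have "(\<Sum>v\<in>UNIV. x $ \<pi> v) = (\<Sum>v\<in>UNIV. x $ v)"
    using sum.permute[OF \<pi>, of "\<lambda>v. x $ v"] by simp
  finally show ?thesis .
qed

lemma
  fixes t :: "'n::{finite,linorder} trop_term"
  assumes nonneg: "\<And>v. 0 \<le> snd (shift_term k t) v" and t': "t' \<in> term_orbit (shift_term k t)"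
  shows output_term_le:
      "term_val {1..CARD('n)} (\<lambda>m. trop_esym m x) (output_term k t') \<le> term_val UNIV (\<lambda>v. x $ v) t"
    and output_term_attained:
      "\<exists>\<sigma>. \<sigma> permutes UNIV \<and> term_val {1..CARD('n)} (\<lambda>m. trop_esym m x) (output_term k t')
        = term_val UNIV (\<lambda>v. permute_vars \<sigma> x $ v) t"
proof -
  obtain \<rho> where \<rho>: "\<rho> permutes UNIV" and t'_eq: "t' = (fst t, \<lambda>v. snd t (\<rho> v) + k)"
    using t' by (auto simp: term_orbit_def shift_term_def comp_def)
  let ?i = "\<lambda>v. nat (snd t' v)"
  have sum_eq: "(\<Sum>v\<in>UNIV. real (?i v) * x $ \<pi> v)
      = (\<Sum>v\<in>UNIV. of_int (snd t v) * x $ \<pi> (inv \<rho> v)) + of_int k * (\<Sum>v\<in>UNIV. x $ v)"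
    if "\<pi> permutes UNIV" for \<pi>
    using sum_shifted_exps[OF that \<rho>, of "snd t" k x] nonneg by (simp add: t'_eq shift_term_def)
  show "term_val {1..CARD('n)} (\<lambda>m. trop_esym m x) (output_term k t') \<le> term_val UNIV (\<lambda>v. x $ v) t"
    using elem_val_le[OF \<rho>, of ?i x] sum_eq[OF \<rho>]
    unfolding term_val_output_term by (simp add: t'_eq term_val_def permutes_inverses[OF \<rho>])
  obtain \<pi> where \<pi>: "\<pi> permutes UNIV" "\<And>v w. ?i w < ?i v \<Longrightarrow> x $ \<pi> v \<le> x $ \<pi> w"
    using ex_antimono_permutation[of ?i "\<lambda>v. x $ v"] by blast
  have "term_val {1..CARD('n)} (\<lambda>m. trop_esym m x) (output_term k t')
      = term_val UNIV (\<lambda>v. permute_vars (\<pi> \<circ> inv \<rho>) x $ v) t"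
    using elem_val_antimono[of \<pi> ?i x, OF \<pi>] sum_eq[OF \<pi>(1)]
    unfolding term_val_output_term by (simp add: t'_eq term_val_def permute_vars_def)
  moreover have "\<pi> \<circ> inv \<rho> permutes UNIV"
    by (intro permutes_compose permutes_inv \<rho> \<pi>)
  ultimately show "\<exists>\<sigma>. \<sigma> permutes UNIV \<and>
      term_val {1..CARD('n)} (\<lambda>m. trop_esym m x) (output_term k t')
        = term_val UNIV (\<lambda>v. permute_vars \<sigma> x $ v) t"
    by blast
qed

lemma term_val_perturb:
  fixes x :: "real ^ 'n::finite"
  shows "term_val UNIV (\<lambda>w. (x + h *\<^sub>R axis v 1) $ w) t
    = term_val UNIV (\<lambda>w. x $ w) t + h * of_int (snd t v)"
proof -
  have "(\<Sum>w\<in>UNIV. of_int (snd t w) * (x + h *\<^sub>R axis v 1) $ w)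
      = (\<Sum>w\<in>UNIV. of_int (snd t w) * x $ w + (if w = v then h * of_int (snd t v) else 0))"
    by (intro sum.cong) (auto simp: axis_def algebra_simps)
  then show ?thesis
    by (simp add: term_val_def sum.distrib)
qed

lemma term_val_permute_vars:
  fixes x :: "real ^ 'n::finite"
  assumes "\<pi> permutes UNIV"
  shows "term_val UNIV (\<lambda>v. permute_vars \<pi> x $ v) t
    = term_val UNIV (\<lambda>v. x $ v) (fst t, snd t \<circ> inv \<pi>)"
  using sum.permute[OF assms, of "\<lambda>v. of_int (snd t (inv \<pi> v)) * x $ v"]
  by (simp add: term_val_def permute_vars_def permutes_inverses[OF assms])

lemma trop_fun_le: "t \<in> set P \<Longrightarrow> trop_fun P x \<le> term_val UNIV (\<lambda>v. x $ v) t"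
  by (simp add: trop_fun_def)

lemma trop_fun_eq:
  assumes "t \<in> set P"
    and "\<And>u. u \<in> set P \<Longrightarrow> term_val UNIV (\<lambda>v. x $ v) t \<le> term_val UNIV (\<lambda>v. x $ v) u"
  shows "trop_fun P x = term_val UNIV (\<lambda>v. x $ v) t"
  unfolding trop_fun_def using assms by (intro Min_eqI) auto

lemma trop_fun_eq_near_strict_min:
  fixes x :: "real ^ 'n::finite"
  assumes t: "t \<in> set P"
    and strict: "\<And>u. u \<in> set P \<Longrightarrow> u \<noteq> t \<Longrightarrow>
      term_val UNIV (\<lambda>v. x $ v) t < term_val UNIV (\<lambda>v. x $ v) u"
  shows "eventually (\<lambda>h. trop_fun P (x + h *\<^sub>R axis v 1)
    = term_val UNIV (\<lambda>w. (x + h *\<^sub>R axis v 1) $ w) t) (nhds 0)"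
proof -
  let ?T = "\<lambda>h. term_val UNIV (\<lambda>w. (x + h *\<^sub>R axis v 1) $ w)"
  have "\<forall>u\<in>set P. eventually (\<lambda>h. ?T h t \<le> ?T h u) (nhds 0)"
  proof
    fix u assume u: "u \<in> set P"
    show "eventually (\<lambda>h. ?T h t \<le> ?T h u) (nhds 0)"
    proof (cases "u = t")
      case False
      have "((\<lambda>h. ?T h u - ?T h t) \<longlongrightarrow> ?T 0 u - ?T 0 t) (nhds 0)"
        unfolding term_val_perturb by (intro tendsto_intros filterlim_ident)
      moreover have "0 < ?T 0 u - ?T 0 t"
        using strict[OF u False] by simp
      ultimately have "eventually (\<lambda>h. 0 < ?T h u - ?T h t) (nhds 0)"
        by (rule order_tendstoD)
      then show ?thesis by eventually_elim simp
    qed simp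
  qed
  then have "eventually (\<lambda>h. \<forall>u\<in>set P. ?T h t \<le> ?T h u) (nhds 0)"
    by (intro eventually_ball_finite) auto
  then show ?thesis
    by eventually_elim (rule trop_fun_eq[OF t], blast)
qed

lemma linear_nonneg_near_zero:
  fixes d :: real
  assumes "eventually (\<lambda>h. 0 \<le> h * d) (nhds 0)"
  shows "d = 0"
proof -
  obtain e where e: "e > 0" "\<And>h. \<bar>h\<bar> < e \<Longrightarrow> 0 \<le> h * d"
    using assms by (auto simp: eventually_nhds_metric)
  have "0 \<le> e * d" "e * d \<le> 0"
    using e(1) e(2)[of "e / 2"] e(2)[of "- (e / 2)"] by simp_all
  then show ?thesis
    using e(1) by (simp add: zero_le_mult_iff mult_le_0_iff)
qed

lemma strict_min_le_permuted:
  fixes x :: "real ^ 'n::finite"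
  assumes sym: "trop_symmetric (trop_fun P)" and \<pi>: "\<pi> permutes UNIV"
    and t: "t \<in> set P" and u: "u \<in> set P"
    and strict: "\<And>u. u \<in> set P \<Longrightarrow> u \<noteq> t \<Longrightarrow>
      term_val UNIV (\<lambda>v. x $ v) t < term_val UNIV (\<lambda>v. x $ v) u"
    and orbit: "t \<notin> term_orbit u"
  shows "term_val UNIV (\<lambda>v. x $ v) t < term_val UNIV (\<lambda>v. permute_vars \<pi> x $ v) u"
proof (rule ccontr)
  define u' where "u' = (fst u, snd u \<circ> inv \<pi>)"
  assume contra: "\<not> ?thesis"
  have le: "trop_fun P y \<le> term_val UNIV (\<lambda>v. y $ v) u'" for y
  proof -
    have "trop_fun P y = trop_fun P (permute_vars \<pi> y)"
      using sym \<pi> by (simp add: trop_symmetric_def)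
    also have "\<dots> \<le> term_val UNIV (\<lambda>v. y $ v) u'"
      using trop_fun_le[OF u, of "permute_vars \<pi> y"] term_val_permute_vars[OF \<pi>, of y u]
      by (simp add: u'_def)
    finally show ?thesis .
  qed
  have "trop_fun P x = term_val UNIV (\<lambda>v. x $ v) t"
    by (rule trop_fun_eq[OF t]) (metis strict order.refl less_imp_le)
  then have eq: "term_val UNIV (\<lambda>v. x $ v) u' = term_val UNIV (\<lambda>v. x $ v) t"
    using le[of x] contra term_val_permute_vars[OF \<pi>, of x u] by (simp add: u'_def)
  have "snd u' v = snd t v" for v
  proof -
    have "eventually (\<lambda>h. trop_fun P (x + h *\<^sub>R axis v 1)
        = term_val UNIV (\<lambda>w. (x + h *\<^sub>R axis v 1) $ w) t) (nhds 0)"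
      by (rule trop_fun_eq_near_strict_min[OF t]) (rule strict)
    then have "eventually (\<lambda>h. 0 \<le> h * (of_int (snd u' v) - of_int (snd t v) :: real)) (nhds 0)"
    proof eventually_elim
      case (elim h)
      then show ?case
        using le[of "x + h *\<^sub>R axis v 1"] eq
        unfolding term_val_perturb by (simp add: algebra_simps)
    qed
    from linear_nonneg_near_zero[OF this] show ?thesis by simp
  qed
  then have "snd u' = snd t" by blast
  moreover from this have "fst u' = fst t"
    using eq by (simp add: term_val_def)
  ultimately have "t = (fst u, snd u \<circ> inv \<pi>)"
    by (metis prod_eqI u'_def)
  then show False
    using orbit permutes_inv[OF \<pi>] by (auto simp: term_orbit_def)
qed

lemma term_orbit_subset:
  assumes "t \<in> term_orbit u"
  shows "term_orbit t \<subseteq> term_orbit u"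
proof
  fix r assume "r \<in> term_orbit t"
  then obtain \<pi> \<rho> where "\<pi> permutes UNIV" "\<rho> permutes UNIV" "r = (fst u, snd u \<circ> \<pi> \<circ> \<rho>)"
    using assms by (auto simp: term_orbit_def)
  then show "r \<in> term_orbit u"
    unfolding term_orbit_def comp_assoc by (blast intro: permutes_compose)
qed

lemma term_orbit_sym:
  assumes "t \<in> term_orbit u"
  shows "u \<in> term_orbit t"
proof -
  obtain \<pi> where \<pi>: "\<pi> permutes UNIV" "t = (fst u, snd u \<circ> \<pi>)"
    using assms by (auto simp: term_orbit_def)
  then have "u = (fst t, snd t \<circ> inv \<pi>)"
    by (simp add: comp_assoc permutes_inv_o)
  then show ?thesis
    using permutes_inv[OF \<pi>(1)] unfolding term_orbit_def by blast
qed

lemma term_orbit_eq: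
  assumes "t \<in> term_orbit u"
  shows "term_orbit t = term_orbit u"
  using term_orbit_subset[OF assms] term_orbit_subset[OF term_orbit_sym[OF assms]]
  by (rule equalityI)

lemma shift_term_in_orbit:
  "t \<in> term_orbit u \<Longrightarrow> shift_term k t \<in> term_orbit (shift_term k u)"
  by (auto simp: term_orbit_def shift_term_def fun_eq_iff)

theorem corollary3p11:
  fixes p :: "real ^ 'n::{finite,linorder} \<Rightarrow> real"
    and P :: "'n::{finite,linorder} trop_term list" and Q :: "nat trop_term list"
  assumes "p \<in> trop_polys"
    and "trop_symmetric p"
    and "minimal_rep P p"
    and "elem_algorithm P Q"
  shows "\<forall>j<length Q. \<exists>x :: real ^ 'n::{finite,linorder}. \<forall>s<length Q. s \<noteq> j \<longrightarrow>
           term_val {1..CARD('n)} (\<lambda>k. trop_esym k x) (Q ! j)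
             < term_val {1..CARD('n)} (\<lambda>k. trop_esym k x) (Q ! s)"
proof (intro allI impI)
  obtain k Os where nonneg: "\<And>t v. t \<in> set P \<Longrightarrow> 0 \<le> snd (shift_term k t) v"
    and Os: "distinct Os" "set Os = term_orbit ` shift_term k ` set P"
    and all2: "list_all2 (\<lambda>T q. \<exists>t\<in>T. q = output_term k t) Os Q"
    using assms(4) unfolding elem_algorithm_def
    by (elim exE conjE) (rule that; simp add: output_term_def)
  have len: "length Os = length Q"
    using all2 by (rule list_all2_lengthD)
  have origin: "\<exists>t\<in>set P. Os ! s = term_orbit (shift_term k t) \<and>
      (\<exists>t'\<in>term_orbit (shift_term k t). Q ! s = output_term k t')" if s: "s < length Q" for s
  proof -
    have "Os ! s \<in> term_orbit ` shift_term k ` set P"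
      using s len Os(2) nth_mem by metis
    then obtain t where t: "t \<in> set P" "Os ! s = term_orbit (shift_term k t)"
      by blast
    moreover have "\<exists>t\<in>Os ! s. Q ! s = output_term k t"
      using list_all2_nthD2[OF all2 s] .
    ultimately show ?thesis by (intro bexI[OF _ t(1)]) auto
  qed
  have sym: "trop_symmetric (trop_fun P)"
    using assms(2,3) by (simp add: minimal_rep_def)
  fix j assume j: "j < length Q"
  from origin[OF j] obtain t t' where t: "t \<in> set P" "Os ! j = term_orbit (shift_term k t)"
    "t' \<in> term_orbit (shift_term k t)" "Q ! j = output_term k t'" by blast
  obtain l where l: "l < length P" "P ! l = t"
    using t(1) by (auto simp: in_set_conv_nth)
  then obtain x :: "real ^ 'n::{finite,linorder}" where x: "\<And>s. s < length P \<Longrightarrow> s \<noteq> l \<Longrightarrow>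
      term_val UNIV (\<lambda>v. x $ v) t < term_val UNIV (\<lambda>v. x $ v) (P ! s)"
    using assms(3) unfolding minimal_rep_def by blast
  have strict: "term_val UNIV (\<lambda>v. x $ v) t < term_val UNIV (\<lambda>v. x $ v) u"
    if "u \<in> set P" "u \<noteq> t" for u
    using that x l by (metis in_set_conv_nth)
  show "\<exists>x :: real ^ 'n::{finite,linorder}. \<forall>s<length Q. s \<noteq> j \<longrightarrow>
      term_val {1..CARD('n)} (\<lambda>k. trop_esym k x) (Q ! j)
        < term_val {1..CARD('n)} (\<lambda>k. trop_esym k x) (Q ! s)"
  proof (intro exI allI impI)
    fix s assume s: "s < length Q" "s \<noteq> j"
    from origin[OF s(1)] obtain u u' where u: "u \<in> set P" "Os ! s = term_orbit (shift_term k u)"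
      "u' \<in> term_orbit (shift_term k u)" "Q ! s = output_term k u'" by blast
    have "Os ! s \<noteq> Os ! j"
      using Os(1) s j len by (simp add: nth_eq_iff_index_eq)
    then have orbit: "t \<notin> term_orbit u"
      using shift_term_in_orbit term_orbit_eq t(2) u(2) by metis
    obtain \<sigma> where \<sigma>: "\<sigma> permutes UNIV" "term_val {1..CARD('n)} (\<lambda>k. trop_esym k x) (Q ! s)
        = term_val UNIV (\<lambda>v. permute_vars \<sigma> x $ v) u"
      using output_term_attained[OF nonneg[OF u(1)] u(3), of x] u(4) by auto
    have "term_val {1..CARD('n)} (\<lambda>k. trop_esym k x) (Q ! j) \<le> term_val UNIV (\<lambda>v. x $ v) t"
      using output_term_le[OF nonneg[OF t(1)] t(3), of x] t(4) by simp
    also have "\<dots> < term_val UNIV (\<lambda>v. permute_vars \<sigma> x $ v) u"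
      by (rule strict_min_le_permuted[OF sym \<sigma>(1) t(1) u(1) _ orbit]) (rule strict)
    finally show "term_val {1..CARD('n)} (\<lambda>k. trop_esym k x) (Q ! j)
        < term_val {1..CARD('n)} (\<lambda>k. trop_esym k x) (Q ! s)"
      unfolding \<sigma>(2) .
  qed
qed

end
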